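(* (i) The Banach density of $N_1$ is zero, i.e. $d^{\ast}(N_1)=0$. (ii) If $f\colon V\rightarrow \mathbb{N}$ is any function such that $f(m)\in \phi^{-1}(m)$ for every $m\in V$, then the asymptotic density of $f(V)$ is $0$. In particular, the asymptotic densities of $N_2$ and $N_3$ are zero.
   Context: $\phi$ denotes Euler's totient function, $V=\{\phi(n)\colon n\in\mathbb{N}\}$, and $\phi^{-1}(m)=\{x\in\mathbb{N}\colon \phi(x)=m\}$. For $m\in V$ let $N_1(m)=\max\{x\in\mathbb{N}\colon \phi(x)\le m\}$, $N_2(m)=\max\phi^{-1}(m)$, $N_3(m)=\min\phi^{-1}(m)$, and $N_i=\{N_i(m)\colon m\in V\}$ for $i=1,2,3$. A Følner sequence in $(\mathbb{N},+)$ is a sequence $(F_n)$ of finite subsets of $\mathbb{N}$ with $\lim_{n\to\infty}|(g+F_n)\cap F_n|/|F_n|=1$ for all $g\in\mathbb{N}$. The upper density of $A\subset\mathbb{N}$ with respect to $(F_n)$ is $\overline d_{F_n}(A)=\limsup_{n\to\infty}|F_n\cap A|/|F_n|$. The asymptotic density is the density (limit of $|F_n\cap A|/|F_n|$, when it exists) with respect to $F_n=\{1,\dots,n\}$. The Banach density is $d^{\ast}(A)=\sup\{\overline d_{F_n}(A)\colon (F_n) \text{ a Følner sequence in }\mathbb{N}\}$. *)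

theory Defs
  imports "HOL-Analysis.Analysis" "HOL-Number_Theory.Number_Theory"
begin

text \<open>
  Here \<open>\<nat>\<close> means the positive integers, \<^term>\<open>{1::nat..}\<close>.
\<close>

definition totient_values :: "nat set" where
  "totient_values = totient ` {1..}"

definition totient_preimage :: "nat \<Rightarrow> nat set" where
  "totient_preimage m = {x \<in> {1..}. totient x = m}"

definition N\<^sub>1 :: "nat \<Rightarrow> nat" where
  "N\<^sub>1 m = Max {x \<in> {1..}. totient x \<le> m}"

definition N\<^sub>2 :: "nat \<Rightarrow> nat" where
  "N\<^sub>2 m = Max (totient_preimage m)"

definition N\<^sub>3 :: "nat \<Rightarrow> nat" where
  "N\<^sub>3 m = Min (totient_preimage m)"

text \<open>\<^const>\<open>Max\<close> and \<^const>\<open>Min\<close> are meaningful above because the sets involved are finite.\<close>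

lemma totient_le_imp_dvd_fact:
  assumes "x > 0" "totient x \<le> m"
  shows "x dvd fact (2 * m)"
proof (rule multiplicity_le_imp_dvd)
  show "x \<noteq> 0" using assms by simp
next
  fix p :: nat assume p: "prime p"
  define k where "k = multiplicity p x"
  have "p ^ k dvd fact (2 * m)"
  proof (cases "k = 0")
    case False
    have "p ^ k dvd x" by (simp add: k_def multiplicity_dvd)
    hence "totient (p ^ k) dvd totient x" by (rule totient_dvd)
    hence le: "totient (p ^ k) \<le> m"
      using assms dvd_imp_le[of _ "totient x"] by fastforce
    have "p \<le> 2 * (p - 1)" using prime_ge_2_nat[OF p] by simp
    hence "p ^ (k - 1) * p \<le> p ^ (k - 1) * (2 * (p - 1))" by (rule mult_le_mono2)
    also have "\<dots> = 2 * totient (p ^ k)"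
      using False p by (simp add: totient_prime_power)
    finally have "p ^ k \<le> 2 * m"
      using le False by (simp add: power_eq_if mult.commute)
    thus ?thesis using p by (intro dvd_fact) (auto simp: Suc_le_eq prime_gt_0_nat)
  qed auto
  thus "multiplicity p x \<le> multiplicity p (fact (2 * m))"
    unfolding k_def using p by (intro multiplicity_geI) auto
qed

lemma finite_totient_le: "finite {x \<in> {1..}. totient x \<le> m}"
  by (rule finite_subset[OF _ finite_divisors_nat[of "fact (2 * m)"]])
     (auto intro: totient_le_imp_dvd_fact)

lemma finite_totient_preimage: "finite (totient_preimage m)"
  unfolding totient_preimage_def by (rule finite_subset[OF _ finite_totient_le[of m]]) auto

text \<open>
  Nonemptiness of the sets need not be required separately: since \<open>0 / 0 = 0\<close>, the limit
  condition forces \<open>F n\<close> to be nonempty for all large \<open>n\<close>.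
\<close>

definition folner_sequence :: "(nat \<Rightarrow> nat set) \<Rightarrow> bool" where
  "folner_sequence F \<longleftrightarrow>
     (\<forall>n. finite (F n) \<and> F n \<subseteq> {1..}) \<and>
     (\<forall>g\<in>{1..}. (\<lambda>n. real (card ((+) g ` F n \<inter> F n)) / real (card (F n))) \<longlonglongrightarrow> 1)"

definition upper_density_wrt :: "(nat \<Rightarrow> nat set) \<Rightarrow> nat set \<Rightarrow> ereal" where
  "upper_density_wrt F A = limsup (\<lambda>n. ereal (real (card (F n \<inter> A)) / real (card (F n))))"

definition has_density_wrt :: "(nat \<Rightarrow> nat set) \<Rightarrow> nat set \<Rightarrow> real \<Rightarrow> bool" where
  "has_density_wrt F A d \<longleftrightarrow> (\<lambda>n. real (card (F n \<inter> A)) / real (card (F n))) \<longlonglongrightarrow> d"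

definition has_asymptotic_density :: "nat set \<Rightarrow> real \<Rightarrow> bool" where
  "has_asymptotic_density A d \<longleftrightarrow> has_density_wrt (\<lambda>n. {1..n}) A d"

definition banach_density :: "nat set \<Rightarrow> ereal" where
  "banach_density A = (SUP F \<in> Collect folner_sequence. upper_density_wrt F A)"

end

theory Submission
  imports Defs
begin

text \<open>
  A set with at most \<open>c\<close> elements in every interval of length \<open>k\<close> has Banach density at most
  \<open>c / k\<close>.  Hence the integers not divisible by any prime in a finite set \<open>P\<close> have Banach density
  at most \<open>\<Prod>p\<in>P. 1 - 1 / p\<close>, a product that tends to \<open>0\<close> as \<open>P\<close> exhausts the primes.

  The values of \<open>N\<^sub>1\<close> are sparsely totient: \<open>\<phi>(x) > \<phi>(n)\<close> for all \<open>x > n\<close>.  Every prime \<open>p\<close> divides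
  all but finitely many sparsely totient \<open>n\<close>, for otherwise exchanging a large factor of \<open>n\<close> for a
  slightly larger multiple of \<open>p\<close> would give some \<open>x > n\<close> with \<open>\<phi>(x) \<le> \<phi>(n)\<close>.  So the Banach density
  is at most \<open>1 / p\<close> for every \<open>p\<close>.

  On the image of a section of \<open>\<phi>\<close>, the function \<open>\<phi>\<close> is injective.  Outside a set of small density,
  all integers have a prime factor between a given \<open>M\<close> and a suitable \<open>N\<close>; iterating this, almost
  all \<open>x\<close> have at least \<open>k\<close> odd prime factors, so that \<open>2\<^sup>k\<close> divides \<open>\<phi>(x) \<le> x\<close>.  Up to a null set,
  \<open>\<phi>\<close> thus maps the image injectively and without increasing elements into the multiples of
  \<open>2\<^sup>k\<close>, which have density \<open>1 / 2\<^sup>k\<close>.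
\<close>

section \<open>Prime factors and the totient function\<close>

lemma prime_factors_prod_primes:
  assumes "finite P" "\<And>p. p \<in> P \<Longrightarrow> prime (p :: nat)"
  shows "prime_factors (\<Prod>P) = P"
proof -
  have "0 \<notin> P" using assms(2) not_prime_0 by blast
  hence "prime_factors (\<Prod>P) = (\<Union>p\<in>P. prime_factors p)"
    using assms(1) prime_factors_prod[of P "\<lambda>p. p"] by simp
  also have "\<dots> = P"
    using assms(2) by (auto simp: prime_prime_factors)
  finally show ?thesis .
qed

lemma totient_mult_le: "totient (a * b) \<le> totient a * b"
proof (cases "a = 0 \<or> b = 0")
  case False
  let ?f = "\<lambda>p. 1 - 1 / real p"
  have f: "0 \<le> ?f p" "?f p \<le> 1" if "p \<in> prime_factors (a * b)" for p
    using that prime_gt_0_nat[of p] by (auto simp: divide_simps)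
  have "prime_factors a \<subseteq> prime_factors (a * b)"
    using False by (simp add: prime_factors_product)
  hence "prod ?f (prime_factors (a * b))
      = prod ?f (prime_factors (a * b) - prime_factors a) * prod ?f (prime_factors a)"
    by (rule prod.subset_diff) simp
  also have "\<dots> \<le> 1 * prod ?f (prime_factors a)"
    using f \<open>prime_factors a \<subseteq> _\<close> by (intro mult_right_mono prod_le_1 prod_nonneg) auto
  finally have "real (a * b) * prod ?f (prime_factors (a * b))
      \<le> real (a * b) * prod ?f (prime_factors a)"
    by (intro mult_left_mono) simp_all
  also have "\<dots> = real a * prod ?f (prime_factors a) * real b" by simp
  finally have "real (totient (a * b)) \<le> real (totient a * b)"
    by (simp only: totient_formula2 of_nat_mult)
  thus ?thesis by (simp only: of_nat_le_iff)
qed auto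

lemma totient_mult_prime_factors_subset:
  assumes "m > 0" "q > 0" "prime_factors q \<subseteq> prime_factors m"
  shows "totient (m * q) = totient m * q"
proof -
  have "prime_factors (m * q) = prime_factors m"
    using assms by (auto simp: prime_factors_product)
  hence "real (totient (m * q)) = real (totient m * q)"
    by (simp add: totient_formula2)
  thus ?thesis by (simp only: of_nat_eq_iff)
qed

lemma totient_mult_prime_ge:
  assumes "prime p"
  shows "totient m * (p - 1) \<le> totient (m * p)"
proof (cases "p dvd m \<and> m > 0")
  case True
  hence "totient (m * p) = totient m * p"
    using assms by (intro totient_mult_prime_factors_subset)
      (auto simp: prime_prime_factors in_prime_factors_iff prime_gt_0_nat)
  thus ?thesis by simp
next
  case False
  thus ?thesis
    using assms prime_imp_coprime[of p m]
    by (cases "m = 0") (auto simp: totient_mult_coprime totient_prime coprime_commute)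
qed

lemma two_power_card_odd_prime_factors_dvd_totient:
  "2 ^ card {p \<in> prime_factors n. 2 < p} dvd totient n"
proof (cases "n = 0")
  case False
  have "(\<Prod>p\<in>{p \<in> prime_factors n. 2 < p}. 2)
      dvd (\<Prod>p\<in>prime_factors n. p ^ (multiplicity p n - 1) * (p - 1))"
    by (intro prod_dvd_prod_subset2 dvd_mult) (auto simp: in_prime_factors_iff prime_odd_nat)
  thus ?thesis
    using False by (simp add: totient_formula1)
qed simp

section \<open>Upper density and Banach density\<close>

definition relative_density :: "'a set \<Rightarrow> 'a set \<Rightarrow> real" where
  "relative_density F A = real (card (F \<inter> A)) / real (card F)"

lemma relative_density_nonneg: "0 \<le> relative_density F A"
  by (simp add: relative_density_def)

lemma relative_density_mono:
  assumes "finite F" "A \<subseteq> B"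
  shows "relative_density F A \<le> relative_density F B"
  unfolding relative_density_def
  using assms by (intro divide_right_mono of_nat_mono card_mono) auto

lemma relative_density_Un_le:
  "relative_density F (A \<union> B) \<le> relative_density F A + relative_density F B"
  using card_Un_le[of "F \<inter> A" "F \<inter> B"]
  by (simp add: relative_density_def Int_Un_distrib divide_right_mono
      flip: add_divide_distrib of_nat_add)

lemma relative_density_Compl_le:
  assumes "finite F"
  shows "relative_density F (- A) \<le> 1 - relative_density F A"
proof -
  have "real (card (F \<inter> - A)) = real (card F) - real (card (F \<inter> A))"
    using assms by (simp add: card_Diff_subset_Int card_mono flip: Diff_eq)
  thus ?thesis by (simp add: relative_density_def diff_divide_distrib)
qed

lemma upper_density_wrt_eq_limsup_relative_density:
  "upper_density_wrt F A = limsup (\<lambda>n. ereal (relative_density (F n) A))"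
  by (simp add: upper_density_wrt_def relative_density_def)

lemma upper_density_wrt_mono:
  assumes "\<And>n. finite (F n)" "A \<subseteq> B"
  shows "upper_density_wrt F A \<le> upper_density_wrt F B"
  unfolding upper_density_wrt_eq_limsup_relative_density
  using assms by (intro Limsup_mono always_eventually) (simp add: relative_density_mono)

lemma upper_density_wrt_Un_le:
  "upper_density_wrt F (A \<union> B) \<le> upper_density_wrt F A + upper_density_wrt F B"
proof -
  have "upper_density_wrt F (A \<union> B)
      \<le> limsup (\<lambda>n. ereal (relative_density (F n) A) + ereal (relative_density (F n) B))"
    unfolding upper_density_wrt_eq_limsup_relative_density
    by (intro Limsup_mono always_eventually) (simp add: relative_density_Un_le)
  also have "\<dots> \<le> upper_density_wrt F A + upper_density_wrt F B"
    unfolding upper_density_wrt_eq_limsup_relative_density by (rule ereal_limsup_add_mono)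
  finally show ?thesis .
qed

lemma has_density_wrt_0I:
  assumes "upper_density_wrt F A \<le> 0"
  shows "has_density_wrt F A 0"
proof -
  have "(\<lambda>n. relative_density (F n) A) \<longlonglongrightarrow> 0"
  proof (rule tendstoI)
    fix e :: real
    assume "0 < e"
    hence "upper_density_wrt F A < ereal e"
      using assms by (simp add: order.strict_trans1)
    hence "\<forall>\<^sub>F n in sequentially. ereal (relative_density (F n) A) < ereal e"
      unfolding upper_density_wrt_eq_limsup_relative_density by (rule Limsup_lessD)
    thus "\<forall>\<^sub>F n in sequentially. dist (relative_density (F n) A) 0 < e"
      by (simp add: relative_density_nonneg)
  qed
  thus ?thesis by (simp add: has_density_wrt_def relative_density_def)
qed

lemma upper_density_wrt_le_banach_density:
  "folner_sequence F \<Longrightarrow> upper_density_wrt F A \<le> banach_density A"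
  unfolding banach_density_def by (rule SUP_upper) simp

lemma folner_sequence_finite: "folner_sequence F \<Longrightarrow> finite (F n)"
  by (simp add: folner_sequence_def)

lemma folner_sequence_atLeast1AtMost: "folner_sequence (\<lambda>n. {1..n})"
  unfolding folner_sequence_def
proof (intro conjI allI ballI)
  fix g :: nat
  have "(\<lambda>n. 1 - real g / real n) \<longlonglongrightarrow> 1 - 0"
    by (intro tendsto_intros lim_const_over_n)
  moreover have "\<forall>\<^sub>F n in sequentially.
      1 - real g / real n = real (card ((+) g ` {1..n} \<inter> {1..n})) / real (card {1..n})"
    using eventually_ge_at_top[of "g + 1"]
  proof eventually_elim
    case (elim n)
    have "(+) g ` {1..n} \<inter> {1..n} = {g + 1..n}" using elim by auto
    thus ?case using elim by (simp add: field_simps)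
  qed
  ultimately show "(\<lambda>n. real (card ((+) g ` {1..n} \<inter> {1..n})) / real (card {1..n})) \<longlonglongrightarrow> 1"
    by (simp add: tendsto_cong)
qed auto

lemma banach_density_nonneg: "0 \<le> banach_density A"
proof -
  have "0 \<le> upper_density_wrt (\<lambda>n. {1..n}) A"
    unfolding upper_density_wrt_eq_limsup_relative_density
    by (intro le_Limsup) (simp_all add: relative_density_nonneg)
  also have "\<dots> \<le> banach_density A"
    using folner_sequence_atLeast1AtMost by (rule upper_density_wrt_le_banach_density)
  finally show ?thesis .
qed

lemma banach_density_mono:
  assumes "A \<subseteq> B"
  shows "banach_density A \<le> banach_density B"
  unfolding banach_density_def
  using assms
  by (intro SUP_subset_mono upper_density_wrt_mono) (auto simp: folner_sequence_finite)

lemma banach_density_Un_le: "banach_density (A \<union> B) \<le> banach_density A + banach_density B"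
  unfolding banach_density_def[of "A \<union> B"]
proof (rule SUP_least)
  fix F
  assume "F \<in> Collect folner_sequence"
  hence F: "folner_sequence F" by simp
  have "upper_density_wrt F (A \<union> B) \<le> upper_density_wrt F A + upper_density_wrt F B"
    by (rule upper_density_wrt_Un_le)
  also have "\<dots> \<le> banach_density A + banach_density B"
    using F by (intro add_mono upper_density_wrt_le_banach_density)
  finally show "upper_density_wrt F (A \<union> B) \<le> banach_density A + banach_density B" .
qed

lemma banach_density_eq_0I:
  assumes "\<And>e. 0 < e \<Longrightarrow> banach_density A \<le> ereal e"
  shows "banach_density A = 0"
proof (rule antisym)
  show "banach_density A \<le> 0"
    by (rule ereal_le_epsilon2) (simp add: assms)
qed (rule banach_density_nonneg)

section \<open>Bounding the Banach density by counting in intervals\<close>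

lemma folner_sequence_Compl_shift_tendsto_0:
  assumes F: "folner_sequence F" and g: "1 \<le> g"
  shows "(\<lambda>n. relative_density (F n) (- (+) g ` F n)) \<longlonglongrightarrow> 0"
proof (rule tendsto_sandwich[where f = "\<lambda>_. 0"])
  have "(\<lambda>n. relative_density (F n) ((+) g ` F n)) \<longlonglongrightarrow> 1"
    using F g by (simp add: folner_sequence_def relative_density_def Int_commute)
  hence "(\<lambda>n. 1 - relative_density (F n) ((+) g ` F n)) \<longlonglongrightarrow> 1 - 1"
    by (intro tendsto_intros)
  thus "(\<lambda>n. 1 - relative_density (F n) ((+) g ` F n)) \<longlonglongrightarrow> 0" by simp
qed (use folner_sequence_finite[OF F] in
    \<open>auto simp: relative_density_nonneg relative_density_Compl_le\<close>)

lemma mult_card_Int_le_sum_windows: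
  fixes F B :: "nat set"
  assumes "finite F"
  shows "k * card (F \<inter> B)
      \<le> (\<Sum>x\<in>F. card (B \<inter> {x<..x + k})) + (\<Sum>g = 1..k. card (F \<inter> - (+) g ` F))"
proof -
  have "card (F \<inter> B) \<le> card {x \<in> F. g + x \<in> B} + card (F \<inter> - (+) g ` F)" for g
  proof -
    have "F \<inter> B \<subseteq> (+) g ` {x \<in> F. g + x \<in> B} \<union> (F \<inter> - (+) g ` F)" by auto
    hence "card (F \<inter> B) \<le> card ((+) g ` {x \<in> F. g + x \<in> B} \<union> (F \<inter> - (+) g ` F))"
      using assms by (intro card_mono) auto
    also have "\<dots> \<le> card ((+) g ` {x \<in> F. g + x \<in> B}) + card (F \<inter> - (+) g ` F)"
      by (rule card_Un_le)
    finally show ?thesis by (simp add: card_image)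
  qed
  hence "k * card (F \<inter> B)
      \<le> (\<Sum>g = 1..k. card {x \<in> F. g + x \<in> B} + card (F \<inter> - (+) g ` F))"
    using sum_mono[of "{1..k}" "\<lambda>_. card (F \<inter> B)"] by simp
  also have "\<dots> = (\<Sum>g = 1..k. card {x \<in> F. g + x \<in> B}) + (\<Sum>g = 1..k. card (F \<inter> - (+) g ` F))"
    by (rule sum.distrib)
  also have "(\<Sum>g = 1..k. card {x \<in> F. g + x \<in> B}) = (\<Sum>x\<in>F. card {g \<in> {1..k}. g + x \<in> B})"
    using assms by (intro sum_multicount_gen) auto
  also have "\<dots> = (\<Sum>x\<in>F. card (B \<inter> {x<..x + k}))"
  proof (intro sum.cong refl bij_betw_same_card)
    fix x
    show "bij_betw (\<lambda>g. g + x) {g \<in> {1..k}. g + x \<in> B} (B \<inter> {x<..x + k})"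
      by (rule bij_betw_byWitness[where f' = "\<lambda>y. y - x"]) auto
  qed
  finally show ?thesis .
qed

lemma relative_density_le_windows:
  fixes F B :: "nat set"
  assumes F: "finite F" and k: "k > 0" and window: "\<And>y. card (B \<inter> {y<..y + k}) \<le> c"
  shows "relative_density F B
      \<le> (real c + (\<Sum>g = 1..k. relative_density F (- (+) g ` F))) / real k"
proof (cases "card F = 0")
  case True
  thus ?thesis by (simp add: relative_density_def)
next
  case False
  have "k * card (F \<inter> B)
      \<le> (\<Sum>x\<in>F. card (B \<inter> {x<..x + k})) + (\<Sum>g = 1..k. card (F \<inter> - (+) g ` F))"
    using F by (rule mult_card_Int_le_sum_windows)
  also have "(\<Sum>x\<in>F. card (B \<inter> {x<..x + k})) \<le> card F * c"
    using sum_bounded_above[of F _ c] window by simp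
  finally have "real (k * card (F \<inter> B))
      \<le> real (card F * c + (\<Sum>g = 1..k. card (F \<inter> - (+) g ` F)))"
    by (simp only: of_nat_le_iff add_le_cancel_right)
  also have "\<dots> = real (card F) * (real c + (\<Sum>g = 1..k. relative_density F (- (+) g ` F)))"
    using False by (simp add: relative_density_def distrib_left flip: sum_divide_distrib)
  finally show ?thesis
    using False k by (simp add: relative_density_def[of F B] field_simps)
qed

lemma banach_density_le_windows:
  assumes k: "k > 0" and window: "\<And>y. card (B \<inter> {y<..y + k}) \<le> c"
  shows "banach_density B \<le> ereal (real c / real k)"
  unfolding banach_density_def
proof (rule SUP_least)
  fix F
  assume "F \<in> Collect folner_sequence"
  hence F: "folner_sequence F" by simp
  let ?bound = "\<lambda>n. (real c + (\<Sum>g = 1..k. relative_density (F n) (- (+) g ` F n))) / real k"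
  have "(\<lambda>n. \<Sum>g = 1..k. relative_density (F n) (- (+) g ` F n)) \<longlonglongrightarrow> (\<Sum>g = 1..k. 0)"
    by (intro tendsto_sum folner_sequence_Compl_shift_tendsto_0[OF F]) simp
  hence "?bound \<longlonglongrightarrow> (real c + (\<Sum>g = 1..k. 0)) / real k"
    using k by (intro tendsto_divide tendsto_add tendsto_const) auto
  hence "(\<lambda>n. ereal (?bound n)) \<longlonglongrightarrow> ereal (real c / real k)"
    by simp
  hence lim: "limsup (\<lambda>n. ereal (?bound n)) = ereal (real c / real k)"
    by (intro lim_imp_Limsup) auto
  have "relative_density (F n) B \<le> ?bound n" for n
    using folner_sequence_finite[OF F] k window by (rule relative_density_le_windows)
  hence "upper_density_wrt F B \<le> limsup (\<lambda>n. ereal (?bound n))"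
    unfolding upper_density_wrt_eq_limsup_relative_density
    by (intro Limsup_mono always_eventually) simp
  with lim show "upper_density_wrt F B \<le> ereal (real c / real k)" by simp
qed

lemma banach_density_finite:
  assumes "finite B"
  shows "banach_density B = 0"
proof (rule banach_density_eq_0I)
  fix e :: real
  assume e: "0 < e"
  obtain k :: nat where k: "real (card B) / e < real k"
    using reals_Archimedean2 by blast
  have "0 \<le> real (card B) / e" using e by simp
  hence k0: "k > 0" using k by simp
  have "banach_density B \<le> ereal (real (card B) / real k)"
    using assms by (intro banach_density_le_windows k0 card_mono) auto
  also have "\<dots> \<le> ereal e" using k k0 e by (simp add: field_simps)
  finally show "banach_density B \<le> ereal e" .
qed

lemma card_Int_period:
  fixes B :: "nat set"
  assumes period: "\<And>x. x + k \<in> B \<longleftrightarrow> x \<in> B"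
  shows "card (B \<inter> {y<..y + k}) = card (B \<inter> {0<..k})"
proof (induction y)
  case (Suc y)
  have "card (B \<inter> {Suc y<..Suc y + k}) = card (B \<inter> {y<..y + k})"
  proof (cases "k = 0")
    case False
    hence "{Suc y<..Suc y + k} = insert (Suc y + k) {Suc y<..y + k}"
      and "{y<..y + k} = insert (Suc y) {Suc y<..y + k}" by auto
    thus ?thesis using period[of "Suc y"] by (simp add: Int_insert_right)
  qed simp
  with Suc.IH show ?case by simp
qed simp

lemma banach_density_le_period:
  assumes "k > 0" "\<And>x. x + k \<in> B \<longleftrightarrow> x \<in> B"
  shows "banach_density B \<le> ereal (real (card (B \<inter> {0<..k})) / real k)"
  using assms by (intro banach_density_le_windows) (simp_all add: card_Int_period)

lemma banach_density_multiples_le: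
  assumes "d > 0"
  shows "banach_density {n. d dvd n} \<le> ereal (1 / real d)"
proof -
  have "{n. d dvd n} \<inter> {0<..d} = {d}"
    using assms by (auto dest: dvd_imp_le)
  thus ?thesis
    using banach_density_le_period[of d "{n. d dvd n}"] assms by simp
qed

lemma banach_density_not_dvd_primes_le:
  assumes P: "finite P" "\<And>p. p \<in> P \<Longrightarrow> prime (p :: nat)"
  shows "banach_density {n. \<forall>p\<in>P. \<not> p dvd n} \<le> ereal (\<Prod>p\<in>P. 1 - 1 / real p)"
proof -
  let ?B = "{n. \<forall>p\<in>P. \<not> p dvd n}"
  have pos: "\<Prod>P > 0"
    using P by (auto simp: prime_gt_0_nat)
  have "coprime n (\<Prod>P) \<longleftrightarrow> (\<forall>p\<in>P. \<not> p dvd n)" for n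
  proof
    show "coprime n (\<Prod>P)" if "\<forall>p\<in>P. \<not> p dvd n"
      using P that by (intro prod_coprime_right) (simp add: prime_imp_coprime coprime_commute)
    show "\<forall>p\<in>P. \<not> p dvd n" if "coprime n (\<Prod>P)"
      using P that by (meson coprime_common_divisor dvd_prodI not_prime_unit)
  qed
  hence totatives: "?B \<inter> {0<..\<Prod>P} = totatives (\<Prod>P)"
    by (auto simp: in_totatives_iff)
  have "p dvd x + \<Prod>P \<longleftrightarrow> p dvd x" if "p \<in> P" for p x
    using dvd_prodI[of P p "\<lambda>p. p"] P(1) that by (simp add: dvd_add_left_iff)
  hence "banach_density ?B \<le> ereal (real (totient (\<Prod>P)) / real (\<Prod>P))"
    using banach_density_le_period[of "\<Prod>P" ?B] pos by (simp add: totatives totient_def)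
  also have "prime_factors (\<Prod>P) = P"
    using P by (rule prime_factors_prod_primes)
  hence "real (totient (\<Prod>P)) / real (\<Prod>P) = (\<Prod>p\<in>P. 1 - 1 / real p)"
    using pos by (simp add: totient_formula2 del: of_nat_prod)
  finally show ?thesis .
qed

section \<open>Sparsely totient numbers\<close>

definition sparsely_totient :: "nat \<Rightarrow> bool" where
  "sparsely_totient n \<longleftrightarrow> (\<forall>x>n. totient n < totient x)"

text \<open>
  Replacing the factor \<open>q\<close> of \<open>m q\<close> by the next multiple of \<open>p\<close> gains a factor of \<open>1 - 1/p\<close> in the
  totient, which outweighs the increase of at most \<open>p\<close> once \<open>q \<ge> p\<^sup>2\<close>.
\<close>

lemma sparsely_totient_factor_less:
  assumes sparse: "sparsely_totient (m * q)" and p: "prime p" "\<not> p dvd m" and m: "m > 0"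
    and le: "totient m * (q - 1) \<le> totient (m * q)"
  shows "q < p\<^sup>2"
proof (rule ccontr)
  assume "\<not> q < p\<^sup>2"
  define j where "j = q div p + 1"
  have p0: "p > 0" using p by (simp add: prime_gt_0_nat)
  have "p \<le> q div p"
    using \<open>\<not> q < p\<^sup>2\<close> p0 by (simp add: less_eq_div_iff_mult_less_eq power2_eq_square)
  hence j: "p + 1 \<le> j" by (simp add: j_def)
  have next_multiple: "q < p * j" "p * j \<le> q + p"
    using mult_div_mod_eq[of p q] mod_less_divisor[OF p0, of q]
    unfolding j_def distrib_left by linarith+
  have "totient (m * p * j) \<le> totient (m * p) * j" by (rule totient_mult_le)
  also have "totient (m * p) = totient m * (p - 1)"
    using p prime_imp_coprime[of p m]
    by (simp add: totient_mult_coprime totient_prime coprime_commute)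
  also have "totient m * (p - 1) * j = totient m * (p * j - j)"
    by (simp add: diff_mult_distrib)
  also have "\<dots> \<le> totient m * (q - 1)"
    using next_multiple j by (intro mult_le_mono2) simp
  also note le
  finally have "totient (m * p * j) \<le> totient (m * q)" .
  moreover have "m * q < m * p * j"
    using next_multiple m p0 by (simp add: mult.assoc)
  ultimately show False
    using sparse unfolding sparsely_totient_def by (meson not_less)
qed

lemma sparsely_totient_prime_factor_less:
  assumes "sparsely_totient n" "prime p" "\<not> p dvd n" "r \<in> prime_factors n"
  shows "r < p\<^sup>2"
proof -
  obtain m where m: "n = m * r"
    using in_prime_factors_imp_dvd[OF assms(4)] by (metis dvd_def mult.commute)
  have "prime r" using assms(4) by auto
  with assms m show ?thesis
    by (intro sparsely_totient_factor_less[of m r p] totient_mult_prime_ge) (auto intro: Nat.gr0I)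
qed

lemma sparsely_totient_eq_mult_prod_prime_factors:
  assumes "sparsely_totient n" "prime p" "\<not> p dvd n"
  obtains q where "q < p\<^sup>2" "n = \<Prod>(prime_factors n) * q"
proof -
  define m where "m = \<Prod>(prime_factors n)"
  have n0: "n > 0" using assms by (auto intro: Nat.gr0I)
  have "m dvd (\<Prod>r\<in>prime_factors n. r ^ multiplicity r n)"
    unfolding m_def by (intro prod_dvd_prod dvd_power) (auto simp: prime_factors_multiplicity)
  hence "m dvd n" using prime_factorization_nat[of n] n0 by simp
  then obtain q where q: "n = m * q" by (rule dvdE)
  hence "m > 0" "q > 0" using n0 by auto
  have "prime_factors m = prime_factors n"
    unfolding m_def by (rule prime_factors_prod_primes) auto
  moreover have "prime_factors q \<subseteq> prime_factors n"
    using q n0 by (intro dvd_prime_factors) auto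
  ultimately have "totient (m * q) = totient m * q"
    using \<open>m > 0\<close> \<open>q > 0\<close> by (intro totient_mult_prime_factors_subset) auto
  hence "q < p\<^sup>2"
    using assms q \<open>m > 0\<close> by (intro sparsely_totient_factor_less[of m q p]) auto
  with q that show ?thesis by (simp add: m_def)
qed

lemma finite_sparsely_totient_not_dvd:
  assumes "prime p"
  shows "finite {n. sparsely_totient n \<and> \<not> p dvd n}"
proof (rule finite_subset)
  show "{n. sparsely_totient n \<and> \<not> p dvd n}
      \<subseteq> (\<lambda>(P, q). \<Prod>P * q) ` (Pow {..<p\<^sup>2} \<times> {..<p\<^sup>2})"
  proof clarify
    fix n
    assume n: "sparsely_totient n" "\<not> p dvd n"
    obtain q where "q < p\<^sup>2" "n = \<Prod>(prime_factors n) * q"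
      using n(1) assms n(2) by (rule sparsely_totient_eq_mult_prod_prime_factors)
    moreover have "prime_factors n \<subseteq> {..<p\<^sup>2}"
      using sparsely_totient_prime_factor_less assms n by blast
    ultimately show "n \<in> (\<lambda>(P, q). \<Prod>P * q) ` (Pow {..<p\<^sup>2} \<times> {..<p\<^sup>2})"
      by (intro image_eqI[of _ _ "(prime_factors n, q)"]) auto
  qed
qed auto

lemma banach_density_sparsely_totient: "banach_density {n. sparsely_totient n} = 0"
proof (rule banach_density_eq_0I)
  fix e :: real
  assume e: "0 < e"
  obtain p where p: "prime p" "nat \<lceil>1 / e\<rceil> < p"
    using bigger_prime by blast
  have p0: "p > 0" using p by (simp add: prime_gt_0_nat)
  have "1 / e < real p" using p by linarith
  hence "1 / real p \<le> e" using e p0 by (simp add: field_simps)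
  have "banach_density {n. sparsely_totient n}
      \<le> banach_density ({n. sparsely_totient n \<and> \<not> p dvd n} \<union> {n. p dvd n})"
    by (rule banach_density_mono) auto
  also have "\<dots> \<le> banach_density {n. sparsely_totient n \<and> \<not> p dvd n} + banach_density {n. p dvd n}"
    by (rule banach_density_Un_le)
  also have "\<dots> \<le> 0 + ereal (1 / real p)"
    using finite_sparsely_totient_not_dvd[OF p(1)] p0
    by (intro add_mono banach_density_multiples_le) (simp_all add: banach_density_finite)
  also have "\<dots> \<le> ereal e"
    using \<open>1 / real p \<le> e\<close> by simp
  finally show "banach_density {n. sparsely_totient n} \<le> ereal e" .
qed

lemma sparsely_totient_N1:
  assumes "m \<in> totient_values"
  shows "sparsely_totient (N\<^sub>1 m)"
proof -
  let ?S = "{x \<in> {1..}. totient x \<le> m}"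
  have "m \<ge> 1"
    using assms by (auto simp: totient_values_def Suc_le_eq)
  hence "1 \<in> ?S" by simp
  hence "totient (N\<^sub>1 m) \<le> m"
    unfolding N\<^sub>1_def using Max_in[OF finite_totient_le[of m]] by blast
  moreover have "m < totient x" if "N\<^sub>1 m < x" for x
    using that Max_ge[OF finite_totient_le[of m], of x] unfolding N\<^sub>1_def by fastforce
  ultimately show ?thesis
    unfolding sparsely_totient_def by (blast intro: order.strict_trans1)
qed

section \<open>Divisibility of totients by powers of two\<close>

lemma totient_mult_sum_inverse_divisors_le:
  "real (totient n) * (\<Sum>d | d dvd n. 1 / real d) \<le> real n"
proof (cases "n = 0")
  case False
  have "real (totient n) * (1 / real d) \<le> real (totient (n div d))" if "d dvd n" for d
  proof -
    have "d > 0" using that False by (auto intro: Nat.gr0I)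
    have "totient n \<le> totient (n div d) * d"
      using totient_mult_le[of "n div d" d] that by simp
    hence "real (totient n) \<le> real (totient (n div d) * d)" by (rule of_nat_mono)
    thus ?thesis using \<open>d > 0\<close> by (simp add: field_simps)
  qed
  hence "real (totient n) * (\<Sum>d | d dvd n. 1 / real d) \<le> (\<Sum>d | d dvd n. real (totient (n div d)))"
    unfolding sum_distrib_left by (intro sum_mono) simp
  also have "(\<Sum>d | d dvd n. real (totient (n div d))) = (\<Sum>d | d dvd n. real (totient d))"
    using False by (intro sum.reindex_bij_witness[of _ "(div) n" "(div) n"]) auto
  also have "\<dots> = real n"
    using totient_divisor_sum[of n] by (simp flip: of_nat_sum)
  finally show ?thesis .
qed simp

lemma prod_one_minus_inverse_primes_mult_harm_le_1:
  "(\<Prod>p | prime p \<and> p \<le> N. 1 - 1 / real p) * harm N \<le> 1"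
proof -
  let ?n = "fact N :: nat"
  have "prime_factors ?n = {p. prime p \<and> p \<le> N}"
    by (auto simp: prime_factors_fact prime_ge_2_nat)
  hence totient: "real (totient ?n) = real ?n * (\<Prod>p | prime p \<and> p \<le> N. 1 - 1 / real p)"
    by (simp add: totient_formula2)
  have "harm N = (\<Sum>d = 1..N. 1 / real d)"
    by (simp add: harm_def inverse_eq_divide)
  also have "\<dots> \<le> (\<Sum>d | d dvd ?n. 1 / real d)"
    by (intro sum_mono2) (auto simp: dvd_fact)
  finally have "real (totient ?n) * harm N \<le> real (totient ?n) * (\<Sum>d | d dvd ?n. 1 / real d)"
    by (rule mult_left_mono) simp
  also have "\<dots> \<le> real ?n"
    by (rule totient_mult_sum_inverse_divisors_le)
  finally show ?thesis
    unfolding totient by (simp add: mult.assoc mult_le_cancel_left1)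
qed

lemma prod_one_minus_inverse_primes_tendsto_0: "(\<lambda>N. \<Prod>p | prime p \<and> p \<le> N. 1 - 1 / real p) \<longlonglongrightarrow> 0"
proof (rule tendsto_sandwich)
  show "\<forall>\<^sub>F N in sequentially. 0 \<le> (\<Prod>p | prime p \<and> p \<le> N. 1 - 1 / real p)"
    by (intro always_eventually allI prod_nonneg) (auto dest: prime_gt_0_nat)
  show "\<forall>\<^sub>F N in sequentially. (\<Prod>p | prime p \<and> p \<le> N. 1 - 1 / real p) \<le> inverse (harm N)"
    using eventually_gt_at_top[of 0]
  proof eventually_elim
    case (elim N)
    thus ?case
      using prod_one_minus_inverse_primes_mult_harm_le_1[of N] harm_pos[of N, where ?'a = real]
      by (simp add: field_simps)
  qed
  show "(\<lambda>N. inverse (harm N :: real)) \<longlonglongrightarrow> 0"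
    by (intro tendsto_inverse_0_at_top harm_at_top)
qed auto

lemma ex_prod_one_minus_inverse_primes_less:
  assumes "0 < e"
  shows "\<exists>N. (\<Prod>p | prime p \<and> M < p \<and> p \<le> N. 1 - 1 / real p) < e"
proof -
  let ?f = "\<lambda>p. 1 - 1 / real p"
  let ?c = "\<Prod>p | prime p \<and> p \<le> M. ?f p"
  have c: "?c > 0"
    by (intro prod_pos) (auto dest: prime_gt_1_nat)
  have "\<forall>\<^sub>F N in sequentially. (\<Prod>p | prime p \<and> p \<le> N. ?f p) < e * ?c"
    using assms c by (intro order_tendstoD[OF prod_one_minus_inverse_primes_tendsto_0]) simp
  hence "\<forall>\<^sub>F N in sequentially. (\<Prod>p | prime p \<and> M < p \<and> p \<le> N. ?f p) < e"
    using eventually_ge_at_top[of M]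
  proof eventually_elim
    case (elim N)
    have "{p. prime p \<and> p \<le> N} = {p. prime p \<and> M < p \<and> p \<le> N} \<union> {p. prime p \<and> p \<le> M}"
      using elim(2) by auto
    hence "(\<Prod>p | prime p \<and> p \<le> N. ?f p) = (\<Prod>p | prime p \<and> M < p \<and> p \<le> N. ?f p) * ?c"
      by (simp only:) (rule prod.union_disjoint; auto)
    thus ?case using elim(1) c by simp
  qed
  thus ?thesis
    by (rule eventually_happens'[OF sequentially_bot])
qed

definition few_prime_factors_above :: "nat \<Rightarrow> nat \<Rightarrow> nat set" where
  "few_prime_factors_above M k = {n. 0 < n \<and> card {p \<in> prime_factors n. M < p} < k}"

lemma few_prime_factors_above_Suc_subset:
  "few_prime_factors_above M (Suc k)
    \<subseteq> {n. \<forall>p\<in>{p. prime p \<and> M < p \<and> p \<le> N}. \<not> p dvd n} \<union> few_prime_factors_above N k"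
proof
  fix n
  assume n: "n \<in> few_prime_factors_above M (Suc k)"
  have "card {p \<in> prime_factors n. N < p} < k"
    if q: "prime q" "M < q" "q \<le> N" "q dvd n" for q
  proof -
    have "q \<in> {p \<in> prime_factors n. M < p}" "q \<notin> {p \<in> prime_factors n. N < p}"
      using n q by (auto simp: few_prime_factors_above_def in_prime_factors_iff)
    moreover have "{p \<in> prime_factors n. N < p} \<subseteq> {p \<in> prime_factors n. M < p}"
      using q by auto
    ultimately have "{p \<in> prime_factors n. N < p} \<subset> {p \<in> prime_factors n. M < p}"
      by blast
    hence "card {p \<in> prime_factors n. N < p} < card {p \<in> prime_factors n. M < p}"
      by (intro psubset_card_mono) simp_all
    thus ?thesis using n by (simp add: few_prime_factors_above_def)
  qed
  thus "n \<in> {n. \<forall>p\<in>{p. prime p \<and> M < p \<and> p \<le> N}. \<not> p dvd n} \<union> few_prime_factors_above N k"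
    using n by (auto simp: few_prime_factors_above_def)
qed

lemma banach_density_few_prime_factors_above: "banach_density (few_prime_factors_above M k) = 0"
proof (induction k arbitrary: M)
  case 0
  show ?case by (simp add: few_prime_factors_above_def banach_density_finite)
next
  case (Suc k)
  show ?case
  proof (rule banach_density_eq_0I)
    fix e :: real
    assume "0 < e"
    then obtain N where N: "(\<Prod>p | prime p \<and> M < p \<and> p \<le> N. 1 - 1 / real p) < e"
      using ex_prod_one_minus_inverse_primes_less by blast
    let ?P = "{p. prime p \<and> M < p \<and> p \<le> N}"
    have "banach_density (few_prime_factors_above M (Suc k))
        \<le> banach_density ({n. \<forall>p\<in>?P. \<not> p dvd n} \<union> few_prime_factors_above N k)"
      by (intro banach_density_mono few_prime_factors_above_Suc_subset)
    also have "\<dots> \<le> banach_density {n. \<forall>p\<in>?P. \<not> p dvd n}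
        + banach_density (few_prime_factors_above N k)"
      by (rule banach_density_Un_le)
    also have "\<dots> \<le> ereal (\<Prod>p\<in>?P. 1 - 1 / real p) + 0"
      using Suc.IH by (intro add_mono banach_density_not_dvd_primes_le) auto
    also have "\<dots> \<le> ereal e"
      using N by simp
    finally show "banach_density (few_prime_factors_above M (Suc k)) \<le> ereal e" .
  qed
qed

lemma banach_density_not_power_two_dvd_totient:
  "banach_density {n. \<not> 2 ^ k dvd totient n} = 0"
proof (rule antisym)
  have "2 ^ k dvd totient n" if "k \<le> card {p \<in> prime_factors n. 2 < p}" for n
    using two_power_card_odd_prime_factors_dvd_totient le_imp_power_dvd[OF that]
    by (rule dvd_trans[rotated])
  hence "{n. \<not> 2 ^ k dvd totient n} \<subseteq> few_prime_factors_above 2 k"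
    by (auto simp: few_prime_factors_above_def not_less[symmetric] intro: Nat.gr0I)
  from banach_density_mono[OF this] show "banach_density {n. \<not> 2 ^ k dvd totient n} \<le> 0"
    by (simp add: banach_density_few_prime_factors_above)
qed (rule banach_density_nonneg)

section \<open>Sets on which the totient function is injective\<close>

lemma upper_density_wrt_atLeast1AtMost_le_image:
  assumes inj: "inj_on f A" and f: "\<And>x. x \<in> A \<Longrightarrow> 0 < x \<Longrightarrow> 0 < f x \<and> f x \<le> x"
  shows "upper_density_wrt (\<lambda>n. {1..n}) A \<le> upper_density_wrt (\<lambda>n. {1..n}) (f ` A)"
  unfolding upper_density_wrt_eq_limsup_relative_density
proof (intro Limsup_mono always_eventually allI)
  fix n
  have "card ({1..n} \<inter> A) \<le> card ({1..n} \<inter> f ` A)"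
  proof (rule card_inj_on_le[of f])
    show "inj_on f ({1..n} \<inter> A)" using inj by (rule inj_on_subset) simp
    show "f ` ({1..n} \<inter> A) \<subseteq> {1..n} \<inter> f ` A"
      using f by (fastforce simp: Suc_le_eq intro: order.trans)
  qed simp
  thus "ereal (relative_density {1..n} A) \<le> ereal (relative_density {1..n} (f ` A))"
    by (simp add: relative_density_def divide_right_mono)
qed

lemma upper_density_wrt_inj_on_totient_le:
  assumes inj: "inj_on totient A"
  shows "upper_density_wrt (\<lambda>n. {1..n}) A \<le> ereal (1 / 2 ^ k)"
proof -
  let ?d = "upper_density_wrt (\<lambda>n. {1..n})"
  note le_banach = upper_density_wrt_le_banach_density[OF folner_sequence_atLeast1AtMost]
  define G where "G = {n \<in> A. 2 ^ k dvd totient n}"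
  have "?d G \<le> ?d (totient ` G)"
    using inj by (intro upper_density_wrt_atLeast1AtMost_le_image)
      (auto simp: G_def totient_le intro: inj_on_subset)
  also have "\<dots> \<le> ?d {n. 2 ^ k dvd n}"
    by (intro upper_density_wrt_mono) (auto simp: G_def)
  also have "\<dots> \<le> banach_density {n. 2 ^ k dvd n}"
    by (rule le_banach)
  also have "\<dots> \<le> ereal (1 / 2 ^ k)"
    using banach_density_multiples_le[of "2 ^ k"] by simp
  finally have G: "?d G \<le> ereal (1 / 2 ^ k)" .
  have null: "?d {n. \<not> 2 ^ k dvd totient n} \<le> 0"
    using le_banach banach_density_not_power_two_dvd_totient by metis
  have "?d A \<le> ?d ({n. \<not> 2 ^ k dvd totient n} \<union> G)"
    by (intro upper_density_wrt_mono) (auto simp: G_def)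
  also have "\<dots> \<le> ?d {n. \<not> 2 ^ k dvd totient n} + ?d G"
    by (rule upper_density_wrt_Un_le)
  also have "\<dots> \<le> 0 + ereal (1 / 2 ^ k)"
    using null G by (rule add_mono)
  finally show ?thesis by simp
qed

lemma has_asymptotic_density_inj_on_totient:
  assumes "inj_on totient A"
  shows "has_asymptotic_density A 0"
  unfolding has_asymptotic_density_def
proof (rule has_density_wrt_0I, rule ereal_le_epsilon2)
  fix e :: real
  assume "0 < e"
  then obtain k where "(1 / 2) ^ k < e"
    using real_arch_pow_inv[of e "1 / 2"] by auto
  hence "ereal (1 / 2 ^ k) \<le> 0 + ereal e"
    by (simp add: power_one_over)
  with upper_density_wrt_inj_on_totient_le[OF assms]
  show "upper_density_wrt (\<lambda>n. {1..n}) A \<le> 0 + ereal e"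
    by (rule order.trans)
qed

lemma has_asymptotic_density_totient_section:
  assumes "\<And>m. m \<in> totient_values \<Longrightarrow> f m \<in> totient_preimage m"
  shows "has_asymptotic_density (f ` totient_values) 0"
proof (rule has_asymptotic_density_inj_on_totient)
  have "totient (f m) = m" if "m \<in> totient_values" for m
    using assms[OF that] by (simp add: totient_preimage_def)
  thus "inj_on totient (f ` totient_values)" by (auto simp: inj_on_def)
qed

theorem theorem1p3:
  shows "banach_density (N\<^sub>1 ` totient_values) = 0
    \<and> (\<forall>f :: nat \<Rightarrow> nat. (\<forall>m\<in>totient_values. f m \<in> totient_preimage m)
          \<longrightarrow> has_asymptotic_density (f ` totient_values) 0)
    \<and> has_asymptotic_density (N\<^sub>2 ` totient_values) 0
    \<and> has_asymptotic_density (N\<^sub>3 ` totient_values) 0"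
proof (intro conjI allI impI)
  have "banach_density (N\<^sub>1 ` totient_values) \<le> banach_density {n. sparsely_totient n}"
    by (intro banach_density_mono) (auto intro: sparsely_totient_N1)
  thus "banach_density (N\<^sub>1 ` totient_values) = 0"
    using banach_density_nonneg by (simp add: banach_density_sparsely_totient antisym)
  have nonempty: "totient_preimage m \<noteq> {}" if "m \<in> totient_values" for m
    using that by (auto simp: totient_values_def totient_preimage_def)
  show "has_asymptotic_density (N\<^sub>2 ` totient_values) 0"
    unfolding N\<^sub>2_def
    by (intro has_asymptotic_density_totient_section Max_in finite_totient_preimage nonempty)
  show "has_asymptotic_density (N\<^sub>3 ` totient_values) 0"
    unfolding N\<^sub>3_def
    by (intro has_asymptotic_density_totient_section Min_in finite_totient_preimage nonempty)
qed (auto intro: has_asymptotic_density_totient_section)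

end
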